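(* Let $ABC$ and $A_1B_1C_1$ be (non-degenerate) triangles in the Euclidean plane with $AB=c$, $BC=a$, $CA=b$ and $A_1B_1=c_1$, $B_1C_1=a_1$, $C_1A_1=b_1$. Let $\theta$ be one of the three interior angles of $\triangle ABC$ and let $\theta_1$ be the corresponding interior angle of $\triangle A_1B_1C_1$. If $a=a_1$, $b=b_1$ and $\theta=\theta_1$, then either $\triangle ABC$ and $\triangle A_1B_1C_1$ are congruent, or they are not congruent, $\theta$ is not the included angle $\angle ACB$, and the sum of the other two angles not included between the given sides is two right angles ($180^\circ$). That is, in the non-congruent case: if $\theta=\angle ABC$ and $\theta_1=\angle A_1B_1C_1$, then $\angle BAC+\angle B_1A_1C_1=180^\circ$; if $\theta=\angle BAC$ and $\theta_1=\angle B_1A_1C_1$, then $\angle ABC+\angle A_1B_1C_1=180^\circ$.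
   Context: Corresponding elements of the two triangles are those matched by the vertex correspondence $A\leftrightarrow A_1$, $B\leftrightarrow B_1$, $C\leftrightarrow C_1$. The given sides are $a=BC$, $b=CA$ (respectively $a_1,b_1$), and the angle included between them is $\angle ACB$ (respectively $\angle A_1C_1B_1$). Congruent means equal in all respects: all corresponding sides and angles are equal. *)

theory Defs
  imports "HOL-Analysis.Analysis"
begin

text \<open>A triangle is an ordered triple of points of the plane; the order of the vertices fixes
  the correspondence \<open>A \<leftrightarrow> A1\<close>, \<open>B \<leftrightarrow> B1\<close>, \<open>C \<leftrightarrow> C1\<close>.\<close>

definition nondegenerate_triangle :: "real^2 \<Rightarrow> real^2 \<Rightarrow> real^2 \<Rightarrow> bool" where
  "nondegenerate_triangle A B C \<longleftrightarrow> \<not> collinear {A, B, C}"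

text \<open>\<open>angle P Q R\<close> is the unoriented angle \<open>\<angle>PQR\<close> with vertex \<open>Q\<close>, in radians. It is meaningful
  only for \<open>P \<noteq> Q\<close> and \<open>R \<noteq> Q\<close>, and then lies in \<open>[0, pi]\<close>.\<close>

definition angle :: "real^2 \<Rightarrow> real^2 \<Rightarrow> real^2 \<Rightarrow> real" where
  "angle P Q R = arccos (((P - Q) \<bullet> (R - Q)) / (norm (P - Q) * norm (R - Q)))"

text \<open>Which of the three interior angles is meant is recorded by the position of its vertex and
  not by its measure: in an isosceles triangle two different interior angles have the same
  measure.\<close>

datatype vertex = Vertex_A | Vertex_B | Vertex_C

primrec interior_angle :: "real^2 \<Rightarrow> real^2 \<Rightarrow> real^2 \<Rightarrow> vertex \<Rightarrow> real" where
  "interior_angle A B C Vertex_A = angle B A C"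
| "interior_angle A B C Vertex_B = angle A B C"
| "interior_angle A B C Vertex_C = angle A C B"

definition congruent_triangles ::
  "real^2 \<Rightarrow> real^2 \<Rightarrow> real^2 \<Rightarrow> real^2 \<Rightarrow> real^2 \<Rightarrow> real^2 \<Rightarrow> bool" where
  "congruent_triangles A B C A1 B1 C1 \<longleftrightarrow>
     dist A B = dist A1 B1 \<and> dist B C = dist B1 C1 \<and> dist C A = dist C1 A1 \<and>
     (\<forall>v. interior_angle A B C v = interior_angle A1 B1 C1 v)"

end

theory Submission
  imports Defs
begin

text \<open>By the law of cosines the side \<open>c\<close> is a root of the quadratic
  \<open>x\<^sup>2 - 2 a cos B x + a\<^sup>2 - b\<^sup>2\<close>, whose coefficients depend only on the data when the angle
  at \<open>B\<close> is given. If \<open>c\<close> and \<open>c1\<close> are distinct, they are its two roots, so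
  \<open>c c1 = a\<^sup>2 - b\<^sup>2\<close>; hence \<open>cos A = (c - c1) / (2 b) = - cos A1\<close>, and the angles at \<open>A\<close> and
  \<open>A1\<close> are supplementary. A given angle at \<open>A\<close> is the same case
  with \<open>A\<close> and \<open>B\<close> interchanged. If \<open>c = c1\<close>, the triangles are congruent, and this is forced
  when the angle at \<open>C\<close> is given.\<close>

text \<open>This is Cauchy-Schwarz; coinciding points are covered because division by zero gives 0.
  The bound lets \<open>cos\<close> undo the \<open>arccos\<close> in \<open>angle\<close>.\<close>

lemma abs_angle_arg_le_1: "\<bar>((P - Q) \<bullet> (R - Q)) / (norm (P - Q) * norm (R - Q))\<bar> \<le> 1"
  for P Q R :: "real^2"
proof -
  have "\<bar>(P - Q) \<bullet> (R - Q)\<bar> \<le> norm (P - Q) * norm (R - Q)"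
    by (rule Cauchy_Schwarz_ineq2)
  moreover have "\<bar>x / y\<bar> \<le> 1" if "\<bar>x\<bar> \<le> y" for x y :: real
    using that by (cases "y = 0") simp_all
  ultimately show ?thesis by blast
qed

lemma angle_nonneg: "0 \<le> angle P Q R" and angle_le_pi: "angle P Q R \<le> pi"
proof -
  have "-1 \<le> x \<and> x \<le> 1" if "\<bar>x\<bar> \<le> 1" for x :: real
    using that by linarith
  from this[OF abs_angle_arg_le_1[of P Q R]] show "0 \<le> angle P Q R" "angle P Q R \<le> pi"
    unfolding angle_def by (blast intro: arccos_lbound arccos_ubound)+
qed

text \<open>Polarization: distances determine the inner product, which gives both the law of cosines
  and the fact that three sides fix the angles.\<close>

lemma inner_eq_dists:
  "2 * ((P - Q) \<bullet> (R - Q)) = (dist P Q)\<^sup>2 + (dist Q R)\<^sup>2 - (dist P R)\<^sup>2"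
  for P Q R :: "'a::real_inner"
  by (simp add: dist_norm power2_norm_eq_inner inner_diff_left inner_diff_right inner_commute)

lemma law_of_cosines:
  "(dist P R)\<^sup>2 = (dist P Q)\<^sup>2 + (dist Q R)\<^sup>2 - 2 * dist P Q * dist Q R * cos (angle P Q R)"
proof -
  have "cos (angle P Q R) = ((P - Q) \<bullet> (R - Q)) / (norm (P - Q) * norm (R - Q))"
    unfolding angle_def by (rule cos_arccos_abs[OF abs_angle_arg_le_1])
  then have "dist P Q * dist Q R * cos (angle P Q R) = (P - Q) \<bullet> (R - Q)"
    \<comment> \<open>If \<open>P = Q\<close> or \<open>R = Q\<close>, both sides vanish, whatever
      value \<open>angle\<close> takes there.\<close>
    by (cases "P = Q \<or> R = Q") (auto simp: dist_norm norm_minus_commute)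
  then show ?thesis
    using inner_eq_dists[of P Q R] by simp
qed

lemma angle_eq_if_dists_eq:
  assumes "dist P Q = dist P1 Q1" "dist Q R = dist Q1 R1" "dist P R = dist P1 R1"
  shows "angle P Q R = angle P1 Q1 R1"
proof -
  have "(P - Q) \<bullet> (R - Q) = (P1 - Q1) \<bullet> (R1 - Q1)"
    using inner_eq_dists[of P Q R] inner_eq_dists[of P1 Q1 R1] assms by simp
  moreover have "norm (P - Q) = norm (P1 - Q1)" "norm (R - Q) = norm (R1 - Q1)"
    using assms by (simp_all add: dist_norm norm_minus_commute)
  ultimately show ?thesis
    by (simp add: angle_def)
qed

lemma congruent_triangles_SSS:
  assumes "dist A B = dist A1 B1" "dist B C = dist B1 C1" "dist C A = dist C1 A1"
  shows "congruent_triangles A B C A1 B1 C1"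
proof -
  have "interior_angle A B C v = interior_angle A1 B1 C1 v" for v
    using assms by (cases v) (auto simp: dist_commute intro!: angle_eq_if_dists_eq)
  with assms show ?thesis
    by (simp add: congruent_triangles_def)
qed

lemma dist_eq_SAS:
  assumes "dist P Q = dist P1 Q1" "dist Q R = dist Q1 R1" "angle P Q R = angle P1 Q1 R1"
  shows "dist P R = dist P1 R1"
proof -
  have "(dist P R)\<^sup>2 = (dist P1 R1)\<^sup>2"
    using assms by (simp only: law_of_cosines[of P R Q] law_of_cosines[of P1 R1 Q1])
  then show ?thesis by simp
qed

lemma angles_supplementary_SSA:
  assumes "A \<noteq> B" "A1 \<noteq> B1" "A \<noteq> C"
    and BC: "dist B C = dist B1 C1" and AC: "dist A C = dist A1 C1"
    and ang: "angle A B C = angle A1 B1 C1"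
    and ne: "dist A B \<noteq> dist A1 B1"
  shows "angle B A C + angle B1 A1 C1 = pi"
proof -
  define a b c c1 where "a = dist B C" "b = dist A C" "c = dist A B" "c1 = dist A1 B1"
  note defs = this
  have pos: "b > 0" "c > 0" "c1 > 0"
    using assms by (auto simp: defs)
  have root: "b\<^sup>2 = c\<^sup>2 + a\<^sup>2 - 2 * c * a * cos (angle A B C)"
    "b\<^sup>2 = c1\<^sup>2 + a\<^sup>2 - 2 * c1 * a * cos (angle A B C)"
    using law_of_cosines[of A C B] law_of_cosines[of A1 C1 B1] BC AC ang
    by (simp_all add: defs)
  \<comment> \<open>The difference of the two equations factors; since \<open>c\<close> and
    \<open>c1\<close> differ, the second factor is the one that vanishes.\<close>
  then have "(c - c1) * (c + c1 - 2 * a * cos (angle A B C)) = 0"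
    by (simp add: algebra_simps power2_eq_square)
  then have sum: "2 * a * cos (angle A B C) = c + c1"
    using ne by (simp add: defs)
  have "b\<^sup>2 = c\<^sup>2 + a\<^sup>2 - c * (2 * a * cos (angle A B C))"
    using root(1) by simp
  \<comment> \<open>The product of the roots comes from putting their sum into the equation for
    \<open>c\<close>.\<close>
  then have prod: "a\<^sup>2 - b\<^sup>2 = c * c1"
    unfolding sum by (simp add: algebra_simps power2_eq_square)
  have "a\<^sup>2 = c\<^sup>2 + b\<^sup>2 - 2 * c * b * cos (angle B A C)"
    "a\<^sup>2 = c1\<^sup>2 + b\<^sup>2 - 2 * c1 * b * cos (angle B1 A1 C1)"
    using law_of_cosines[of B C A] law_of_cosines[of B1 C1 A1] BC AC
    by (simp_all add: defs dist_commute)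
  \<comment> \<open>Replacing \<open>a\<^sup>2 - b\<^sup>2\<close> by \<open>c * c1\<close> leaves a
    common factor \<open>c\<close> in the first equation and \<open>c1\<close> in the second;
    positivity cancels them.\<close>
  with prod have "c * (2 * b * cos (angle B A C)) = c * (c - c1)"
    "c1 * (2 * b * cos (angle B1 A1 C1)) = c1 * (c1 - c)"
    by (simp_all add: algebra_simps power2_eq_square)
  then have "2 * b * cos (angle B A C) = c - c1" "2 * b * cos (angle B1 A1 C1) = c1 - c"
    using pos by simp_all
  \<comment> \<open>The supplement \<open>pi - angle B1 A1 C1\<close> again lies in
    \<open>[0, pi]\<close>, where \<open>cos\<close> is injective, so comparing cosines is
    enough.\<close>
  then have "2 * b * cos (angle B A C) = 2 * b * cos (pi - angle B1 A1 C1)"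
    by simp
  then have "cos (angle B A C) = cos (pi - angle B1 A1 C1)"
    by (rule mult_left_cancel[THEN iffD1, rotated]) (use pos in simp)
  then have "angle B A C = pi - angle B1 A1 C1"
    by (rule cos_inj_pi[rotated 4]) (simp_all add: angle_nonneg angle_le_pi)
  then show ?thesis by simp
qed

lemma nondegenerate_triangle_distinct:
  assumes "nondegenerate_triangle A B C"
  shows "A \<noteq> B" "B \<noteq> C" "A \<noteq> C"
  using assms by (auto simp: nondegenerate_triangle_def insert_commute)

theorem theorem2p4:
  fixes A B C A1 B1 C1 :: "real^2"
    and a b c a1 b1 c1 \<theta> \<theta>1 :: real
    and v :: vertex
  assumes "nondegenerate_triangle A B C" and "nondegenerate_triangle A1 B1 C1"
    and "dist A B = c" and "dist B C = a" and "dist C A = b"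
    and "dist A1 B1 = c1" and "dist B1 C1 = a1" and "dist C1 A1 = b1"
    and "\<theta> = interior_angle A B C v" and "\<theta>1 = interior_angle A1 B1 C1 v"
    and "a = a1" and "b = b1" and "\<theta> = \<theta>1"
  shows "congruent_triangles A B C A1 B1 C1 \<or>
    (\<not> congruent_triangles A B C A1 B1 C1 \<and>
     v \<noteq> Vertex_C \<and>
     (v = Vertex_B \<longrightarrow> angle B A C + angle B1 A1 C1 = pi) \<and>
     (v = Vertex_A \<longrightarrow> angle A B C + angle A1 B1 C1 = pi))"
proof -
  note distinct = nondegenerate_triangle_distinct[OF assms(1)]
    nondegenerate_triangle_distinct[OF assms(2)]
  have BC: "dist B C = dist B1 C1" and AC: "dist A C = dist A1 C1"
    using assms by (simp_all add: dist_commute)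
  have ang: "interior_angle A B C v = interior_angle A1 B1 C1 v"
    using assms by simp
  show ?thesis
  proof (cases "dist A B = dist A1 B1")
    case True
    with BC AC show ?thesis
      by (simp add: congruent_triangles_SSS dist_commute)
  next
    case False
    then have "\<not> congruent_triangles A B C A1 B1 C1"
      by (simp add: congruent_triangles_def)
    moreover have "v \<noteq> Vertex_C"
      \<comment> \<open>An angle at \<open>C\<close> lies between the two given sides, so SAS would
        make \<open>AB\<close> and \<open>A1B1\<close> equal.\<close>
      using dist_eq_SAS[of A C A1 C1 B B1] False BC AC ang by (auto simp: dist_commute)
    moreover have "angle B A C + angle B1 A1 C1 = pi" if "v = Vertex_B"
      using angles_supplementary_SSA[of A B A1 B1 C C1] that False BC AC ang distinct by simp
    moreover have "angle A B C + angle A1 B1 C1 = pi" if "v = Vertex_A"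
      using angles_supplementary_SSA[of B A B1 A1 C C1] that False BC AC ang distinct
      by (simp add: dist_commute)
    ultimately show ?thesis by blast
  qed
qed

end
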